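(* Let $f : B(\Omega,\mathcal{A})\rightarrow \mathbb{R}$ be a pricing rule. Then the following are equivalent: (i) $f$ satisfies the Call-Put Parity (CPP); (ii) $f$ satisfies the Put-Call Parity (PCP) and has no bid-ask spreads.
   Context: $\Omega$ is a set (finite or infinite) endowed with a $\sigma$-algebra $\mathcal{A}$, and $B(\Omega,\mathcal{A})$ is the set of all bounded, $\mathcal{A}$-measurable functions $x:\Omega\to\mathbb{R}$, with pointwise operations. For $A\in\mathcal{A}$, $\boldsymbol{1}_A$ is the indicator function of $A$. For $x\in B(\Omega,\mathcal{A})$, $x^+ := x\vee 0$ (pointwise maximum). A pricing rule is a function $f:B(\Omega,\mathcal{A})\to\mathbb{R}$ that is not identically zero (no other property is assumed). For $x\in B(\Omega,\mathcal{A})$ and $k\ge 0$, let $c_{x,k}=(x-k\boldsymbol{1}_\Omega)^+$ (call option) and $p_{x,k}=(k\boldsymbol{1}_\Omega-x)^+$ (put option). PCP: $f(x)= f(c_{x,k})+f(-p_{x,k})+f(k\boldsymbol{1}_\Omega)$ for all $x\in B(\Omega,\mathcal{A})$ and all $k\ge 0$. CPP: $f(p_{x,k})=f(c_{x,k})+f(-x)+f(k\boldsymbol{1}_\Omega)$ for all $x\in B(\Omega,\mathcal{A})$ and all $k\ge 0$. No bid-ask spreads: $f(x)=-f(-x)$ for all $x\in B(\Omega,\mathcal{A})$. *)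

theory Defs
  imports "HOL-Analysis.Analysis"
begin

text \<open>
  Functions \<open>\<Omega> \<rightarrow> \<real>\<close> are represented by the total functions that are \<^const>\<open>extensional\<close> on
  \<open>\<Omega>\<close>; this makes the representation unique, so that a functional on such functions cannot depend on
  values outside \<open>\<Omega>\<close>. Pointwise operations are accordingly restricted to \<open>\<Omega>\<close>.
\<close>

definition bounded_measurable :: "'a set \<Rightarrow> 'a set set \<Rightarrow> ('a \<Rightarrow> real) set" where
  "bounded_measurable \<Omega> \<A> =
    {x \<in> extensional \<Omega>. x \<in> borel_measurable (sigma \<Omega> \<A>) \<and> bounded (x ` \<Omega>)}"

definition const_fn :: "'a set \<Rightarrow> real \<Rightarrow> 'a \<Rightarrow> real" where
  "const_fn \<Omega> k = (\<lambda>\<omega>\<in>\<Omega>. k * indicator \<Omega> \<omega>)"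

definition neg_fn :: "'a set \<Rightarrow> ('a \<Rightarrow> real) \<Rightarrow> 'a \<Rightarrow> real" where
  "neg_fn \<Omega> x = (\<lambda>\<omega>\<in>\<Omega>. - x \<omega>)"

definition diff_fn :: "'a set \<Rightarrow> ('a \<Rightarrow> real) \<Rightarrow> ('a \<Rightarrow> real) \<Rightarrow> 'a \<Rightarrow> real" where
  "diff_fn \<Omega> x y = (\<lambda>\<omega>\<in>\<Omega>. x \<omega> - y \<omega>)"

definition pos_part :: "'a set \<Rightarrow> ('a \<Rightarrow> real) \<Rightarrow> 'a \<Rightarrow> real" where
  "pos_part \<Omega> x = (\<lambda>\<omega>\<in>\<Omega>. max (x \<omega>) 0)"

definition call_option :: "'a set \<Rightarrow> ('a \<Rightarrow> real) \<Rightarrow> real \<Rightarrow> 'a \<Rightarrow> real" where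
  "call_option \<Omega> x k = pos_part \<Omega> (diff_fn \<Omega> x (const_fn \<Omega> k))"

definition put_option :: "'a set \<Rightarrow> ('a \<Rightarrow> real) \<Rightarrow> real \<Rightarrow> 'a \<Rightarrow> real" where
  "put_option \<Omega> x k = pos_part \<Omega> (diff_fn \<Omega> (const_fn \<Omega> k) x)"

text \<open>
  In the following predicates \<open>f\<close> is a total function of which only the values on
  \<^const>\<open>bounded_measurable\<close> matter.
\<close>

definition pricing_rule :: "'a set \<Rightarrow> 'a set set \<Rightarrow> (('a \<Rightarrow> real) \<Rightarrow> real) \<Rightarrow> bool" where
  "pricing_rule \<Omega> \<A> f \<longleftrightarrow> (\<exists>x\<in>bounded_measurable \<Omega> \<A>. f x \<noteq> 0)"

definition put_call_parity :: "'a set \<Rightarrow> 'a set set \<Rightarrow> (('a \<Rightarrow> real) \<Rightarrow> real) \<Rightarrow> bool" where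
  "put_call_parity \<Omega> \<A> f \<longleftrightarrow>
    (\<forall>x\<in>bounded_measurable \<Omega> \<A>. \<forall>k\<ge>0.
      f x = f (call_option \<Omega> x k) + f (neg_fn \<Omega> (put_option \<Omega> x k)) + f (const_fn \<Omega> k))"

definition call_put_parity :: "'a set \<Rightarrow> 'a set set \<Rightarrow> (('a \<Rightarrow> real) \<Rightarrow> real) \<Rightarrow> bool" where
  "call_put_parity \<Omega> \<A> f \<longleftrightarrow>
    (\<forall>x\<in>bounded_measurable \<Omega> \<A>. \<forall>k\<ge>0.
      f (put_option \<Omega> x k) = f (call_option \<Omega> x k) + f (neg_fn \<Omega> x) + f (const_fn \<Omega> k))"

definition no_bid_ask_spreads :: "'a set \<Rightarrow> 'a set set \<Rightarrow> (('a \<Rightarrow> real) \<Rightarrow> real) \<Rightarrow> bool" where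
  "no_bid_ask_spreads \<Omega> \<A> f \<longleftrightarrow> (\<forall>x\<in>bounded_measurable \<Omega> \<A>. f x = - f (neg_fn \<Omega> x))"

lemma const_fn_bounded_measurable: "const_fn \<Omega> k \<in> bounded_measurable \<Omega> \<A>"
proof -
  have "const_fn \<Omega> k ` \<Omega> \<subseteq> {k}"
    by (auto simp: const_fn_def)
  then have "bounded (const_fn \<Omega> k ` \<Omega>)"
    by (rule bounded_subset[rotated]) simp
  moreover have "const_fn \<Omega> k \<in> borel_measurable (sigma \<Omega> \<A>)"
    by (subst measurable_cong[where g = "\<lambda>_. k"]) (auto simp: const_fn_def space_measure_of_conv)
  ultimately show ?thesis
    by (auto simp: bounded_measurable_def const_fn_def)
qed

lemma neg_fn_bounded_measurable:
  assumes "x \<in> bounded_measurable \<Omega> \<A>"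
  shows "neg_fn \<Omega> x \<in> bounded_measurable \<Omega> \<A>"
proof -
  have "neg_fn \<Omega> x ` \<Omega> = uminus ` (x ` \<Omega>)"
    by (auto simp: neg_fn_def image_image)
  then have "bounded (neg_fn \<Omega> x ` \<Omega>)"
    using assms by (simp add: bounded_measurable_def)
  moreover have "neg_fn \<Omega> x \<in> borel_measurable (sigma \<Omega> \<A>)"
    using assms
    by (subst measurable_cong[where g = "\<lambda>\<omega>. - x \<omega>"])
      (auto simp: neg_fn_def space_measure_of_conv bounded_measurable_def)
  ultimately show ?thesis
    by (auto simp: bounded_measurable_def neg_fn_def)
qed

lemma diff_fn_bounded_measurable:
  assumes "x \<in> bounded_measurable \<Omega> \<A>" "y \<in> bounded_measurable \<Omega> \<A>"
  shows "diff_fn \<Omega> x y \<in> bounded_measurable \<Omega> \<A>"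
proof -
  have "bounded (diff_fn \<Omega> x y ` \<Omega>)"
    using bounded_minus_comp[of x \<Omega> y] assms
    by (simp add: bounded_measurable_def diff_fn_def cong: image_cong)
  moreover have "diff_fn \<Omega> x y \<in> borel_measurable (sigma \<Omega> \<A>)"
    using assms
    by (subst measurable_cong[where g = "\<lambda>\<omega>. x \<omega> - y \<omega>"])
      (auto simp: diff_fn_def space_measure_of_conv bounded_measurable_def)
  ultimately show ?thesis
    by (auto simp: bounded_measurable_def diff_fn_def)
qed

lemma pos_part_bounded_measurable:
  assumes "x \<in> bounded_measurable \<Omega> \<A>"
  shows "pos_part \<Omega> x \<in> bounded_measurable \<Omega> \<A>"
proof -
  obtain b where "\<forall>\<omega>\<in>\<Omega>. \<bar>x \<omega>\<bar> \<le> b"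
    using assms by (auto simp: bounded_measurable_def bounded_iff)
  then have "\<forall>\<omega>\<in>\<Omega>. \<bar>pos_part \<Omega> x \<omega>\<bar> \<le> b"
    by (fastforce simp: pos_part_def)
  then have "bounded (pos_part \<Omega> x ` \<Omega>)"
    by (auto simp: bounded_iff)
  moreover have "pos_part \<Omega> x \<in> borel_measurable (sigma \<Omega> \<A>)"
    using assms
    by (subst measurable_cong[where g = "\<lambda>\<omega>. max (x \<omega>) 0"])
      (auto simp: pos_part_def space_measure_of_conv bounded_measurable_def)
  ultimately show ?thesis
    by (auto simp: bounded_measurable_def pos_part_def)
qed

end

theory Submission
  imports Defs
begin

text \<open>Off \<open>\<Omega>\<close> the left side is \<open>undefined\<close>, so extensionality
  of \<open>x\<close> is what gives equality there.\<close>

lemma neg_fn_neg_fn: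
  assumes "x \<in> extensional \<Omega>"
  shows "neg_fn \<Omega> (neg_fn \<Omega> x) = x"
  using assms by (auto simp: neg_fn_def fun_eq_iff extensional_def)

lemma neg_fn_zero: "neg_fn \<Omega> (const_fn \<Omega> 0) = const_fn \<Omega> 0"
  by (auto simp: neg_fn_def const_fn_def fun_eq_iff)

lemma put_option_bounded_measurable:
  assumes "x \<in> bounded_measurable \<Omega> \<A>"
  shows "put_option \<Omega> x k \<in> bounded_measurable \<Omega> \<A>"
  unfolding put_option_def
  by (intro pos_part_bounded_measurable diff_fn_bounded_measurable
      const_fn_bounded_measurable assms)

lemma call_option_zero: "call_option \<Omega> (const_fn \<Omega> 0) 0 = const_fn \<Omega> 0"
  by (auto simp: call_option_def pos_part_def diff_fn_def const_fn_def fun_eq_iff)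

lemma put_option_zero: "put_option \<Omega> (const_fn \<Omega> 0) 0 = const_fn \<Omega> 0"
  by (auto simp: put_option_def pos_part_def diff_fn_def const_fn_def fun_eq_iff)

text \<open>Reflection at strike \<open>k\<close> would yield a call of strike \<open>-k\<close>;
  only \<open>k = 0\<close> keeps both strikes nonnegative.\<close>

lemma put_option_neg_fn: "put_option \<Omega> (neg_fn \<Omega> x) 0 = call_option \<Omega> x 0"
  by (auto simp: put_option_def call_option_def pos_part_def diff_fn_def const_fn_def
      neg_fn_def fun_eq_iff)

lemma call_option_neg_fn: "call_option \<Omega> (neg_fn \<Omega> x) 0 = put_option \<Omega> x 0"
  by (auto simp: put_option_def call_option_def pos_part_def diff_fn_def const_fn_def
      neg_fn_def fun_eq_iff)

text \<open>
  At strike \<open>0\<close> the parity reads \<open>f (x\<^sup>-) = f (x\<^sup>+) + f (- x) + f 0\<close>. Here \<open>x = 0\<close> gives \<open>f 0 = 0\<close>,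
  and replacing \<open>x\<close> by \<open>- x\<close> exchanges \<open>x\<^sup>+\<close> and \<open>x\<^sup>-\<close>.
\<close>

lemma call_put_parity_imp_no_bid_ask_spreads:
  assumes "call_put_parity \<Omega> \<A> f"
  shows "no_bid_ask_spreads \<Omega> \<A> f"
  unfolding no_bid_ask_spreads_def
proof
  fix x assume x: "x \<in> bounded_measurable \<Omega> \<A>"
  have cpp: "f (put_option \<Omega> y 0) = f (call_option \<Omega> y 0) + f (neg_fn \<Omega> y) + f (const_fn \<Omega> 0)"
    if "y \<in> bounded_measurable \<Omega> \<A>" for y
    using assms that by (simp add: call_put_parity_def)
  \<comment> \<open>All four terms coincide here, so the parity reads
    \<open>a = 3 * a\<close>.\<close>
  have "f (const_fn \<Omega> 0) = 0"
    using cpp[OF const_fn_bounded_measurable[of \<Omega> 0]]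
    by (simp add: neg_fn_zero call_option_zero put_option_zero)
  moreover have "neg_fn \<Omega> (neg_fn \<Omega> x) = x"
    using x by (simp add: neg_fn_neg_fn bounded_measurable_def)
  \<comment> \<open>Adding the parities for \<open>x\<close> and its negative cancels the option
    values and leaves \<open>f (neg_fn \<Omega> x) + f x = 0\<close>.\<close>
  ultimately show "f x = - f (neg_fn \<Omega> x)"
    using cpp[OF x] cpp[OF neg_fn_bounded_measurable[OF x]]
    by (simp add: put_option_neg_fn call_option_neg_fn)
qed

text \<open>For each fixed \<open>x\<close> and \<open>k\<close>, the two parities differ only by
  moving the terms of \<open>x\<close> and of the put across the equation, each with a change of
  sign inside \<open>f\<close>.\<close>

lemma call_put_parity_iff_put_call_parity:
  assumes "no_bid_ask_spreads \<Omega> \<A> f"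
  shows "call_put_parity \<Omega> \<A> f \<longleftrightarrow> put_call_parity \<Omega> \<A> f"
proof -
  have "f (put_option \<Omega> x k) = f (call_option \<Omega> x k) + f (neg_fn \<Omega> x) + f (const_fn \<Omega> k) \<longleftrightarrow>
      f x = f (call_option \<Omega> x k) + f (neg_fn \<Omega> (put_option \<Omega> x k)) + f (const_fn \<Omega> k)"
    if x: "x \<in> bounded_measurable \<Omega> \<A>" for x k
  proof -
    have "f x = - f (neg_fn \<Omega> x)"
      using assms x by (simp add: no_bid_ask_spreads_def)
    moreover have "f (put_option \<Omega> x k) = - f (neg_fn \<Omega> (put_option \<Omega> x k))"
      using assms put_option_bounded_measurable[OF x] unfolding no_bid_ask_spreads_def by blast
    ultimately show ?thesis
      by linarith
  qed
  then show ?thesis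
    by (simp add: call_put_parity_def put_call_parity_def)
qed

theorem proposition1:
  fixes \<Omega> :: "'a set" and \<A> :: "'a set set" and f :: "('a \<Rightarrow> real) \<Rightarrow> real"
  assumes "sigma_algebra \<Omega> \<A>"
    and "pricing_rule \<Omega> \<A> f"
  shows "call_put_parity \<Omega> \<A> f \<longleftrightarrow> put_call_parity \<Omega> \<A> f \<and> no_bid_ask_spreads \<Omega> \<A> f"
  \<comment> \<open>Absence of spreads is derived in one direction and given in the other, so the
    equivalence of the parities applies in both.\<close>
  using call_put_parity_imp_no_bid_ask_spreads call_put_parity_iff_put_call_parity by blast

end
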